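(* Let $V$ be a separable metrizable locally convex vector space over $\mathbb{R}$, let $T:V^{\mathbb{N}}\to V^{\mathbb{N}}$ be the Cesaro operator, and let $A\subseteq V$ be an arbitrary subset. Then the set $$\Theta_{A,V}=\{\vartheta\in A^{\mathbb{N}} : \text{for every } k=1,2,\ldots \text{ the sequence } [T^k(\vartheta)]_n,\ n=1,2,\ldots, \text{ is dense in } \operatorname{conv}(A)\}$$ is dense and $G_\delta$ in $A^{\mathbb{N}}$ under the product topology.
   Context: $\mathbb{N}=\{1,2,\ldots\}$. The topology of $V$ is given by a countable separating family of seminorms $\|\cdot\|_i$, $i=1,2,\ldots$ (so $V$ is Hausdorff), and can be generated by the metric $d(x,y)=\sum_{i=1}^\infty \frac{1}{2^i}\frac{\|x-y\|_i}{1+\|x-y\|_i}$. The Cesaro operator $T:V^{\mathbb{N}}\to V^{\mathbb{N}}$ is defined by $[T(a)]_n=\frac{a_1+\cdots+a_n}{n}$ for $a=(a_n)\in V^{\mathbb{N}}$, where $[b]_n$ denotes the $n$-th term of a sequence $b$; $T^1=T$ and $T^k=T\circ T^{k-1}$ for $k\ge 2$. $\operatorname{conv}(A)$ is the convex hull of $A$. $A^{\mathbb{N}}$ carries the product topology, where $A$ has the subspace topology from $V$. *)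

theory Defs
  imports "HOL-Analysis.Analysis"
begin

definition seminorm :: "('v::real_vector \<Rightarrow> real) \<Rightarrow> bool" where
  "seminorm p \<longleftrightarrow>
     (\<forall>x. 0 \<le> p x) \<and>
     (\<forall>c x. p (c *\<^sub>R x) = \<bar>c\<bar> * p x) \<and>
     (\<forall>x y. p (x + y) \<le> p x + p y)"

definition separating :: "('i \<Rightarrow> 'v::real_vector \<Rightarrow> real) \<Rightarrow> bool" where
  "separating p \<longleftrightarrow> (\<forall>x. x \<noteq> 0 \<longrightarrow> (\<exists>i. p i x \<noteq> 0))"

(* The open seminorm balls, with arbitrary centres, are only a subbase. *)
definition seminorm_topology :: "('i \<Rightarrow> 'v::real_vector \<Rightarrow> real) \<Rightarrow> 'v topology" where
  "seminorm_topology p =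
     topology_generated_by {{y. p i (y - x) < r} | i x r. 0 < r}"

(* The index type nat stands for the indices 1, 2, ...; members of the family
   may repeat, so finite families are covered as well. *)
definition metrizable_lcs :: "'v::real_vector topology \<Rightarrow> bool" where
  "metrizable_lcs X \<longleftrightarrow>
     (\<exists>p :: nat \<Rightarrow> 'v \<Rightarrow> real.
        (\<forall>i. seminorm (p i)) \<and> separating p \<and> X = seminorm_topology p)"

(* Sequences are indexed by {1..}. As usual for PiE and product_topology, they are
   functions on nat that are undefined outside the index set. *)
definition cesaro :: "(nat \<Rightarrow> 'v::real_vector) \<Rightarrow> (nat \<Rightarrow> 'v)" where
  "cesaro a = (\<lambda>n\<in>{1..}. (1 / real n) *\<^sub>R (\<Sum>j=1..n. a j))"

definition dense_in :: "'a topology \<Rightarrow> 'a set \<Rightarrow> bool" where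
  "dense_in X S \<longleftrightarrow> S \<subseteq> topspace X \<and> X closure_of S = topspace X"

definition seq_space :: "'v topology \<Rightarrow> 'v set \<Rightarrow> (nat \<Rightarrow> 'v) topology" where
  "seq_space X A = product_topology (\<lambda>_. subtopology X A) {1..}"

definition Theta :: "'v::real_vector topology \<Rightarrow> 'v set \<Rightarrow> (nat \<Rightarrow> 'v) set" where
  "Theta X A =
     {\<theta> \<in> {1..} \<rightarrow>\<^sub>E A. \<forall>k\<ge>1.
        dense_in (subtopology X (convex hull A)) ((cesaro ^^ k) \<theta> ` {1..})}"

end

theory Submission
  imports Defs
begin

text \<open>
  Fix a countable base of \<open>X\<close>. Density of all the iterated Cesaro sequences in the convex hull
  amounts to the countably many conditions ``some term of \<open>T\<^sup>k \<theta>\<close> lies in the base set \<open>B\<close>'', for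
  \<open>k \<ge> 1\<close> and \<open>B\<close> meeting the hull; each is open, since a term of \<open>T\<^sup>k \<theta>\<close> depends continuously on
  finitely many coordinates. As \<open>A\<close> is arbitrary, its powers need not be Baire spaces in the
  given topology, but they are completely metrizable when \<open>A\<close> is made discrete, and density there
  implies density in the coarser product topology. So it suffices that every finite initial
  segment in \<open>A\<close> extends to a sequence satisfying one given condition. Every \<open>x\<close> in the hull is
  the limit of averages of some sequence in \<open>A\<close>; append this sequence to the given segment. Then
  \<open>T \<theta>\<close> tends to \<open>x\<close>, hence so does every \<open>T\<^sup>k \<theta>\<close>.
\<close>

section \<open>Seminorms and their topology\<close>

lemma seminorm_nonneg: "seminorm p \<Longrightarrow> 0 \<le> p x"
  and seminorm_scaleR: "seminorm p \<Longrightarrow> p (c *\<^sub>R x) = \<bar>c\<bar> * p x"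
  and seminorm_triangle: "seminorm p \<Longrightarrow> p (x + y) \<le> p x + p y"
  by (auto simp: seminorm_def)

lemma seminorm_zero [simp]: "seminorm p \<Longrightarrow> p 0 = 0"
  using seminorm_scaleR[of p 0 0] by simp

lemma seminorm_minus_commute: "seminorm p \<Longrightarrow> p (x - y) = p (y - x)"
  using seminorm_scaleR[of p "-1" "x - y"] by simp

lemma seminorm_triangle_diff: "seminorm p \<Longrightarrow> p (x - z) \<le> p (x - y) + p (y - z)"
  using seminorm_triangle[of p "x - y" "y - z"] by simp

lemma seminorm_sum_le:
  assumes "seminorm p"
  shows "p (sum f S) \<le> (\<Sum>i\<in>S. p (f i))"
proof (induction S rule: infinite_finite_induct)
  case (insert i S)
  then show ?case
    using seminorm_triangle[OF assms, of "f i" "sum f S"] by simp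
qed (use assms in simp_all)

text \<open>Lets a finite partial sum of the family be handled as one seminorm, whose balls then
  serve as neighbourhoods.\<close>

lemma seminorm_sum:
  assumes "\<And>i. i \<in> I \<Longrightarrow> seminorm (p i)"
  shows "seminorm (\<lambda>x. \<Sum>i\<in>I. p i x)"
  unfolding seminorm_def
proof (intro conjI allI)
  fix x y c
  show "0 \<le> (\<Sum>i\<in>I. p i x)"
    using assms by (simp add: seminorm_nonneg sum_nonneg)
  show "(\<Sum>i\<in>I. p i (c *\<^sub>R x)) = \<bar>c\<bar> * (\<Sum>i\<in>I. p i x)"
    using assms by (simp add: seminorm_scaleR sum_distrib_left)
  show "(\<Sum>i\<in>I. p i (x + y)) \<le> (\<Sum>i\<in>I. p i x) + (\<Sum>i\<in>I. p i y)"
    using assms by (simp add: seminorm_triangle sum_mono flip: sum.distrib)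
qed

text \<open>With \<open>b\<close> constant this controls the convergence of the means; in general,
  their dependence on the sequence.\<close>

lemma seminorm_average_diff_le:
  assumes p: "seminorm p" and "n \<ge> 1"
  shows "p ((1 / real n) *\<^sub>R (\<Sum>j=1..n. a j) - (1 / real n) *\<^sub>R (\<Sum>j=1..n. b j))
           \<le> (\<Sum>j=1..n. p (a j - b j)) / real n"
proof -
  have "(1 / real n) *\<^sub>R (\<Sum>j=1..n. a j) - (1 / real n) *\<^sub>R (\<Sum>j=1..n. b j)
          = (1 / real n) *\<^sub>R (\<Sum>j=1..n. a j - b j)"
    by (simp add: sum_subtractf scaleR_diff_right)
  then show ?thesis
    using seminorm_sum_le[OF p, of "\<lambda>j. a j - b j" "{1..n}"]
    by (simp add: seminorm_scaleR[OF p] divide_right_mono)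
qed

lemma topspace_seminorm_topology:
  assumes "\<And>i. seminorm (p i)"
  shows "topspace (seminorm_topology p) = UNIV"
proof -
  have "z \<in> \<Union> {{y. p i (y - x) < r} | i x r. 0 < r}" for z
  proof (rule UnionI)
    show "z \<in> {y. p undefined (y - z) < 1}"
      using assms by simp
    show "{y. p undefined (y - z) < 1} \<in> {{y. p i (y - x) < r} | i x r. 0 < r}"
      by (rule CollectI, intro exI conjI, rule refl, simp)
  qed
  then show ?thesis
    unfolding seminorm_topology_def topology_generated_by_topspace by blast
qed

text \<open>The subbase consists of balls of single seminorms. Sharing the slack
  \<open>e - ?q (z - x)\<close> equally among the \<open>Suc m\<close> summands gives finitely many
  such balls around \<open>z\<close> whose intersection stays inside.\<close>

lemma openin_seminorm_ball:
  fixes p :: "nat \<Rightarrow> 'v::real_vector \<Rightarrow> real"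
  assumes "\<And>i. seminorm (p i)"
  shows "openin (seminorm_topology p) {y. (\<Sum>i\<le>m. p i (y - x)) < e}"
proof (subst openin_subopen, intro ballI)
  let ?q = "\<lambda>z. \<Sum>i\<le>m. p i z"
  have q: "seminorm ?q"
    using assms by (intro seminorm_sum)
  fix z assume z: "z \<in> {y. ?q (y - x) < e}"
  define d where "d = (e - ?q (z - x)) / real (Suc m)"
  have d: "d > 0"
    using z by (simp add: d_def)
  let ?W = "\<Inter>i\<le>m. {y. p i (y - z) < d}"
  have "openin (seminorm_topology p) ?W"
    using d unfolding seminorm_topology_def
    by (intro openin_INT2 topology_generated_by_Basis) auto
  moreover have "z \<in> ?W"
    using assms d by simp
  moreover have "?W \<subseteq> {y. ?q (y - x) < e}"
  proof
    fix y assume "y \<in> ?W"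
    then have "?q (y - z) < (\<Sum>i\<le>m. d)"
      by (intro sum_strict_mono) auto
    then have "?q (y - z) < e - ?q (z - x)"
      by (simp add: d_def)
    then show "y \<in> {y. ?q (y - x) < e}"
      using seminorm_triangle_diff[OF q, of y x z] by simp
  qed
  ultimately show "\<exists>T. openin (seminorm_topology p) T \<and> z \<in> T \<and> T \<subseteq> {y. ?q (y - x) < e}"
    by blast
qed

text \<open>Induction on the generation of \<open>U\<close> from the subbase. Partial sums increase
  with \<open>m\<close>, so an intersection takes the larger index and the smaller radius.\<close>

lemma seminorm_topology_nbhd:
  fixes p :: "nat \<Rightarrow> 'v::real_vector \<Rightarrow> real"
  assumes "\<And>i. seminorm (p i)" and "openin (seminorm_topology p) U" and "x \<in> U"
  shows "\<exists>m. \<exists>e>0. {y. (\<Sum>i\<le>m. p i (y - x)) < e} \<subseteq> U"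
proof -
  have mono: "(\<Sum>i\<le>m. p i z) \<le> (\<Sum>i\<le>n. p i z)" if "m \<le> n" for m n :: nat and z
    using assms(1) that by (intro sum_mono2) (auto simp: seminorm_nonneg)
  have "generate_topology_on {{y. p i (y - x) < r} | i x r. 0 < r} U"
    using assms(2) unfolding seminorm_topology_def openin_topology_generated_by_iff .
  then show ?thesis
    using \<open>x \<in> U\<close>
  proof (induction U rule: generate_topology_on.induct)
    case Empty
    then show ?case by simp
  next
    case (Int a b)
    from Int.IH(1)[OF IntD1[OF Int.prems]] obtain m d
      where "d > 0" and a: "{y. (\<Sum>i\<le>m. p i (y - x)) < d} \<subseteq> a" by (elim exE conjE)
    from Int.IH(2)[OF IntD2[OF Int.prems]] obtain n e
      where "e > 0" and b: "{y. (\<Sum>i\<le>n. p i (y - x)) < e} \<subseteq> b" by (elim exE conjE)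
    have "{y. (\<Sum>i\<le>max m n. p i (y - x)) < min d e} \<subseteq> a \<inter> b"
    proof
      fix y assume "y \<in> {y. (\<Sum>i\<le>max m n. p i (y - x)) < min d e}"
      then have "(\<Sum>i\<le>m. p i (y - x)) < d" "(\<Sum>i\<le>n. p i (y - x)) < e"
        using mono[of m "max m n" "y - x"] mono[of n "max m n" "y - x"] by simp_all
      then show "y \<in> a \<inter> b"
        using a b by (simp add: subset_iff)
    qed
    moreover have "min d e > 0"
      using \<open>d > 0\<close> \<open>e > 0\<close> by simp
    ultimately show ?case by (intro exI conjI)
  next
    case (UN K)
    then obtain k where k: "k \<in> K" "x \<in> k" by (elim UnionE)
    from UN.IH[OF this] obtain m e
      where "e > 0" "{y. (\<Sum>i\<le>m. p i (y - x)) < e} \<subseteq> k" by (elim exE conjE)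
    then show ?case
      using k(1) by (intro exI[of _ m] exI[of _ e]) (simp add: Union_upper subset_trans)
  next
    case (Basis s)
    then obtain i z r where s: "s = {y. p i (y - z) < r}" and r: "p i (x - z) < r"
      by auto
    \<comment> \<open>The generating ball is centred at \<open>z\<close>, not at \<open>x\<close>;
      the slack it leaves at \<open>x\<close> becomes the new radius.\<close>
    have "p i (y - z) < r" if "(\<Sum>j\<le>i. p j (y - x)) < r - p i (x - z)" for y
    proof -
      have "p i (y - x) \<le> (\<Sum>j\<le>i. p j (y - x))"
        by (intro member_le_sum) (auto simp: assms(1) seminorm_nonneg)
      then show ?thesis
        using seminorm_triangle_diff[OF assms(1)[of i], of y z x] that by linarith
    qed
    then show ?case
      using r s by (intro exI[of _ i] exI[of _ "r - p i (x - z)"]) auto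
  qed
qed

text \<open>A basic neighbourhood involves only finitely many seminorms, so convergence in each of
  them separately is enough.\<close>

lemma seminorm_topology_eventually:
  fixes p :: "nat \<Rightarrow> 'v::real_vector \<Rightarrow> real"
  assumes "\<And>i. seminorm (p i)" and "openin (seminorm_topology p) U" and "x \<in> U"
    and "\<And>i. ((\<lambda>n. p i (f n - x)) \<longlongrightarrow> 0) F"
  shows "\<forall>\<^sub>F n in F. f n \<in> U"
proof -
  obtain m e where "e > 0" and sub: "{y. (\<Sum>i\<le>m. p i (y - x)) < e} \<subseteq> U"
    using seminorm_topology_nbhd[of p, OF assms(1-3)] by blast
  have "((\<lambda>n. \<Sum>i\<le>m. p i (f n - x)) \<longlongrightarrow> 0) F"
    using tendsto_sum[of "{..m}" "\<lambda>i n. p i (f n - x)" "\<lambda>_. 0" F] assms(4) by simp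
  then have "\<forall>\<^sub>F n in F. (\<Sum>i\<le>m. p i (f n - x)) < e"
    using \<open>e > 0\<close> by (rule order_tendstoD)
  then show ?thesis
    by (rule eventually_mono) (use sub in auto)
qed

text \<open>A base is given by the balls of radius \<open>1 / Suc n\<close> for the partial sums,
  centred in a countable dense set. If \<open>1 / Suc n < e / 2\<close> and \<open>d\<close> is that
  close to \<open>x\<close>, then the ball around \<open>d\<close> contains \<open>x\<close> and
  stays within \<open>e\<close> of \<open>x\<close>.\<close>

lemma second_countable_seminorm_topology:
  fixes p :: "nat \<Rightarrow> 'v::real_vector \<Rightarrow> real"
  assumes p: "\<And>i. seminorm (p i)" and "separable_space (seminorm_topology p)"
  shows "second_countable (seminorm_topology p)"
proof -
  let ?X = "seminorm_topology p"
  obtain D where D: "countable D" "?X closure_of D = UNIV"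
    using assms(2) by (auto simp: separable_space_def topspace_seminorm_topology[of p, OF p])
  define W where "W m n d = {y. (\<Sum>i\<le>m. p i (y - d)) < 1 / real (Suc n)}" for m n d
  have W: "openin ?X (W m n d)" for m n d
    unfolding W_def by (rule openin_seminorm_ball[of p, OF p])
  have "\<exists>m n. \<exists>d\<in>D. x \<in> W m n d \<and> W m n d \<subseteq> U" if U: "openin ?X U" "x \<in> U" for U x
  proof -
    obtain m e where "e > 0" and sub: "{y. (\<Sum>i\<le>m. p i (y - x)) < e} \<subseteq> U"
      using seminorm_topology_nbhd[of p, OF p U] by blast
    let ?q = "\<lambda>z. \<Sum>i\<le>m. p i z"
    have q: "seminorm ?q"
      using p by (intro seminorm_sum)
    obtain n where n: "1 / real (Suc n) < e / 2"
      using \<open>e > 0\<close> by (meson half_gt_zero nat_approx_posE)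
    have "x \<in> W m n x"
      using p by (simp add: W_def)
    then obtain d where d: "d \<in> D" "d \<in> W m n x"
      using D(2) W[of m n x] by (metis UNIV_I in_closure_of)
    have "x \<in> W m n d"
      using d(2) seminorm_minus_commute[OF q, of x d] by (simp add: W_def)
    moreover have "W m n d \<subseteq> U"
    proof
      fix y assume "y \<in> W m n d"
      then have "?q (y - x) < e"
        using d(2) n seminorm_triangle_diff[OF q, of y x d] by (simp add: W_def)
      then show "y \<in> U"
        using sub by blast
    qed
    ultimately show ?thesis
      using d(1) by blast
  qed
  moreover have "countable ((\<lambda>(m, n, d). W m n d) ` (UNIV \<times> UNIV \<times> D))"
    using D(1) by simp
  ultimately show ?thesis
    unfolding second_countable_def using W
    by (intro exI[of _ "(\<lambda>(m, n, d). W m n d) ` (UNIV \<times> UNIV \<times> D)"]) fastforce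
qed

section \<open>Iterated Cesaro means\<close>

text \<open>The first \<open>N\<close> terms contribute at most a fixed total \<open>M\<close>,
  which division by \<open>n\<close> makes small; the later terms are below \<open>e / 2\<close>
  each, hence so is their share of the average.\<close>

lemma average_tendsto_0:
  fixes r :: "nat \<Rightarrow> real"
  assumes lim: "r \<longlonglongrightarrow> 0"
  shows "(\<lambda>n. (\<Sum>j=1..n. r j) / real n) \<longlonglongrightarrow> 0"
proof (rule LIMSEQ_I)
  fix e :: real assume "e > 0"
  then obtain N where N: "\<And>j. j \<ge> N \<Longrightarrow> \<bar>r j\<bar> < e / 2"
    using LIMSEQ_D[OF lim, of "e / 2"] by auto
  define M where "M = (\<Sum>j=1..N. \<bar>r j\<bar>)"
  have "(\<lambda>n. M / real n) \<longlonglongrightarrow> 0"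
    by (rule lim_const_over_n)
  then have "\<forall>\<^sub>F n in sequentially. M / real n < e / 2"
    using \<open>e > 0\<close> by (intro order_tendstoD) auto
  then obtain N' where N': "\<And>n. n \<ge> N' \<Longrightarrow> M / real n < e / 2"
    unfolding eventually_sequentially by blast
  have "norm ((\<Sum>j=1..n. r j) / real n - 0) < e" if n: "n \<ge> max 1 (max N N')" for n
  proof -
    have "\<bar>\<Sum>j=1..n. r j\<bar> \<le> (\<Sum>j=1..n. \<bar>r j\<bar>)"
      by (rule sum_abs)
    also have "\<dots> = M + (\<Sum>j=Suc N..n. \<bar>r j\<bar>)"
      unfolding M_def using n sum.ub_add_nat[of 1 N "\<lambda>j. \<bar>r j\<bar>" "n - N"] by simp
    also have "(\<Sum>j=Suc N..n. \<bar>r j\<bar>) \<le> (\<Sum>j=Suc N..n. e / 2)"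
      by (intro sum_mono less_imp_le N) auto
    also have "\<dots> \<le> real n * (e / 2)"
      using \<open>e > 0\<close> by (simp add: mult_right_mono)
    finally have "\<bar>\<Sum>j=1..n. r j\<bar> / real n \<le> (M + real n * (e / 2)) / real n"
      by (intro divide_right_mono) auto
    also have "\<dots> = M / real n + e / 2"
      using n by (simp add: add_divide_distrib)
    also have "\<dots> < e"
      using N'[of n] n by linarith
    finally show ?thesis
      by simp
  qed
  then show "\<exists>no. \<forall>n\<ge>no. norm ((\<Sum>j=1..n. r j) / real n - 0) < e"
    by blast
qed

lemma average_const: "n \<ge> 1 \<Longrightarrow> (1 / real n) *\<^sub>R (\<Sum>j=1..n. x) = (x :: 'v::real_vector)"
  by (simp add: sum_constant_scaleR)

lemma cesaro_apply: "n \<ge> 1 \<Longrightarrow> cesaro a n = (1 / real n) *\<^sub>R (\<Sum>j=1..n. a j)"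
  by (simp add: cesaro_def)

lemma cesaro_tendsto:
  assumes p: "seminorm p" and lim: "(\<lambda>n. p (a n - x)) \<longlonglongrightarrow> 0"
  shows "(\<lambda>n. p (cesaro a n - x)) \<longlonglongrightarrow> 0"
proof (rule tendsto_sandwich[OF _ _ tendsto_const average_tendsto_0[OF lim]])
  show "\<forall>\<^sub>F n in sequentially. 0 \<le> p (cesaro a n - x)"
    using p by (simp add: seminorm_nonneg)
  show "\<forall>\<^sub>F n in sequentially. p (cesaro a n - x) \<le> (\<Sum>j=1..n. p (a j - x)) / real n"
    using eventually_ge_at_top[of 1]
  proof (rule eventually_mono)
    \<comment> \<open>Index 0 lies outside the sequence, where \<open>cesaro a\<close> is
      \<open>undefined\<close>, so the bound is only claimed from 1 on.\<close>
    fix n :: nat assume "n \<ge> 1"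
    then show "p (cesaro a n - x) \<le> (\<Sum>j=1..n. p (a j - x)) / real n"
      using seminorm_average_diff_le[OF p, of n a "\<lambda>_. x"] average_const[of n x]
      by (simp add: cesaro_apply)
  qed
qed

text \<open>Each further mean preserves the limit. Convergence is assumed of the first mean, not of
  \<open>a\<close>, because the sequences constructed below converge only on average.\<close>

lemma cesaro_iterate_tendsto:
  assumes p: "seminorm p" and "(\<lambda>n. p (cesaro a n - x)) \<longlonglongrightarrow> 0" and "k \<ge> 1"
  shows "(\<lambda>n. p ((cesaro ^^ k) a n - x)) \<longlonglongrightarrow> 0"
  using \<open>k \<ge> 1\<close>
proof (induction k rule: dec_induct)
  case base
  then show ?case using assms(2) by simp
next
  case (step k)
  then show ?case by (simp add: cesaro_tendsto[OF p])
qed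

lemma cesaro_iterate_in_convex:
  assumes "convex C" and "\<And>j. j \<ge> 1 \<Longrightarrow> a j \<in> C" and "n \<ge> 1"
  shows "(cesaro ^^ k) a n \<in> C"
  using \<open>n \<ge> 1\<close>
proof (induction k arbitrary: n)
  case 0
  then show ?case using assms(2) by simp
next
  case (Suc k)
  have "(\<Sum>j=1..n. (1 / real n) *\<^sub>R (cesaro ^^ k) a j) \<in> C"
    using Suc by (intro convex_sum assms(1)) auto
  then show ?case
    using Suc.prems by (simp add: cesaro_apply scaleR_sum_right)
qed

text \<open>An average of quantities below \<open>e\<close> is below \<open>e\<close>, so the same
  bound survives every iteration: no modulus depending on \<open>k\<close> appears.\<close>

lemma cesaro_iterate_diff_less:
  assumes p: "seminorm p" and "\<And>j. j \<in> {1..n} \<Longrightarrow> p (a j - b j) < e" and "n \<ge> 1"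
  shows "p ((cesaro ^^ k) a n - (cesaro ^^ k) b n) < e"
  using assms(2,3)
proof (induction k arbitrary: n)
  case 0
  then show ?case by simp
next
  case (Suc k)
  have "p ((cesaro ^^ Suc k) a n - (cesaro ^^ Suc k) b n)
          \<le> (\<Sum>j=1..n. p ((cesaro ^^ k) a j - (cesaro ^^ k) b j)) / real n"
    using seminorm_average_diff_le[OF p \<open>n \<ge> 1\<close>] Suc.prems(2) by (simp add: cesaro_apply)
  also have "\<dots> < (\<Sum>j=1..n. e) / real n"
    using Suc by (intro divide_strict_right_mono sum_strict_mono) auto
  finally show ?case
    using Suc.prems(2) by simp
qed

lemma openin_cesaro_iterate:
  fixes p :: "nat \<Rightarrow> 'v::real_vector \<Rightarrow> real"
  assumes p: "\<And>i. seminorm (p i)" and U: "openin (seminorm_topology p) U" and "n \<ge> 1"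
  shows "openin (seq_space (seminorm_topology p) A)
           {\<theta> \<in> {1..} \<rightarrow>\<^sub>E A. (cesaro ^^ k) \<theta> n \<in> U}"
proof (subst openin_subopen, intro ballI)
  let ?X = "seminorm_topology p" and ?S = "{\<theta> \<in> {1..} \<rightarrow>\<^sub>E A. (cesaro ^^ k) \<theta> n \<in> U}"
  fix \<theta> assume \<theta>: "\<theta> \<in> ?S"
  then obtain m e where "e > 0"
    and sub: "{y. (\<Sum>i\<le>m. p i (y - (cesaro ^^ k) \<theta> n)) < e} \<subseteq> U"
    using seminorm_topology_nbhd[of p, OF p U] by blast
  let ?q = "\<lambda>z. \<Sum>i\<le>m. p i z"
  have q: "seminorm ?q"
    using p by (intro seminorm_sum)
  \<comment> \<open>Only the coordinates that enter the \<open>n\<close>-th term are restricted,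
    which makes the box open in the product topology.\<close>
  define V where "V j = (if j \<in> {1..n} then {y. ?q (y - \<theta> j) < e} \<inter> A else A)" for j
  have "openin (subtopology ?X A) (V j)" for j
    using openin_seminorm_ball[of p "\<theta> j" m e, OF p]
    by (auto simp: V_def openin_subtopology topspace_seminorm_topology[of p, OF p]
        intro: exI[of _ UNIV] openin_topspace[of ?X, unfolded topspace_seminorm_topology[of p, OF p]])
  moreover have "{j \<in> {1..}. V j \<noteq> topspace (subtopology ?X A)} \<subseteq> {1..n}"
    by (auto simp: V_def topspace_seminorm_topology[of p, OF p])
  ultimately have "openin (seq_space ?X A) (Pi\<^sub>E {1..} V)"
    unfolding seq_space_def openin_PiE_gen by (meson finite_atLeastAtMost finite_subset)
  moreover have "\<theta> \<in> Pi\<^sub>E {1..} V"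
    using \<theta> \<open>e > 0\<close> p by (auto simp: V_def PiE_iff)
  moreover have "Pi\<^sub>E {1..} V \<subseteq> ?S"
  proof
    fix \<eta> assume \<eta>: "\<eta> \<in> Pi\<^sub>E {1..} V"
    then have V: "\<eta> j \<in> V j" if "j \<ge> 1" for j
      using that by auto
    have "?q (\<eta> j - \<theta> j) < e" if "j \<in> {1..n}" for j
      using V[of j] that by (simp add: V_def)
    then have "(cesaro ^^ k) \<eta> n \<in> U"
      using sub cesaro_iterate_diff_less[OF q _ \<open>n \<ge> 1\<close>] by blast
    moreover have "\<eta> \<in> {1..} \<rightarrow>\<^sub>E A"
      using \<eta> by (rule rev_subsetD, intro PiE_mono) (auto simp: V_def)
    ultimately show "\<eta> \<in> ?S"
      by simp
  qed
  ultimately show "\<exists>T. openin (seq_space ?X A) T \<and> \<theta> \<in> T \<and> T \<subseteq> ?S"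
    by blast
qed

section \<open>Averages converging to a point of the convex hull\<close>

lemma interleave_sums:
  fixes f :: "nat \<Rightarrow> nat" and b c :: "nat \<Rightarrow> 'v::comm_monoid_add"
  assumes "f 0 = 0" and "\<And>n. f (Suc n) = f n \<or> f (Suc n) = Suc (f n)"
  defines "w \<equiv> \<lambda>n. if f (Suc n) = Suc (f n) then b (f n) else c (n - f n)"
  shows "f n \<le> n \<and> (\<Sum>j<n. w j) = (\<Sum>j<f n. b j) + (\<Sum>j<n - f n. c j)"
proof (induction n)
  case 0
  then show ?case using assms(1) by simp
next
  case (Suc n)
  show ?case
    using assms(2)[of n] Suc by (auto simp: w_def Suc_diff_le add_ac)
qed

text \<open>
  Bounding the discrepancy, rather than asking for convergence of the averages, makes the
  property stable under convex combinations: interleave two sequences with frequencies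
  \<open>u\<close> and \<open>1 - u\<close>.
\<close>

definition bounded_discrepancy ::
    "('i \<Rightarrow> 'v::real_vector \<Rightarrow> real) \<Rightarrow> (nat \<Rightarrow> 'v) \<Rightarrow> 'v \<Rightarrow> bool" where
  "bounded_discrepancy p b x \<longleftrightarrow> (\<forall>i. \<exists>C. \<forall>n. p i ((\<Sum>j<n. b j) - real n *\<^sub>R x) \<le> C)"

text \<open>The discrepancy of \<open>w\<close> splits into those of \<open>b\<close> and
  \<open>c\<close> and a rounding error, a multiple of \<open>x - y\<close> with coefficient at most
  1 in absolute value.\<close>

lemma bounded_discrepancy_interleave:
  assumes p: "\<And>i. seminorm (p i)" and u: "0 \<le> u" "u \<le> 1"
    and b: "bounded_discrepancy p b x" "range b \<subseteq> A"
    and c: "bounded_discrepancy p c y" "range c \<subseteq> A"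
  shows "\<exists>w. range w \<subseteq> A \<and> bounded_discrepancy p w (u *\<^sub>R x + (1 - u) *\<^sub>R y)"
proof -
  \<comment> \<open>Rounding \<open>n * u\<close> down gives frequency \<open>u\<close>; since
    \<open>u\<close> lies between 0 and 1, the count grows by 0 or 1 at each step.\<close>
  define f where "f n = nat \<lfloor>real n * u\<rfloor>" for n
  define w where "w = (\<lambda>n. if f (Suc n) = Suc (f n) then b (f n) else c (n - f n))"
  have f0: "f 0 = 0"
    by (simp add: f_def)
  have f_real: "real (f n) = of_int \<lfloor>real n * u\<rfloor>" for n
    using u by (simp add: f_def)
  have f_bounds: "real (f n) \<le> real n * u" "real n * u < real (f n) + 1" for n
    unfolding f_real by linarith+
  have f_Suc: "f (Suc n) = f n \<or> f (Suc n) = Suc (f n)" for n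
  proof -
    have "real (Suc n) * u = real n * u + u"
      by (simp add: algebra_simps)
    then have "real (f (Suc n)) < real (f n) + 2" "real (f n) < real (f (Suc n)) + 1"
      using f_bounds[of n] f_bounds[of "Suc n"] u by linarith+
    then show ?thesis by linarith
  qed
  have sums: "f n \<le> n" "(\<Sum>j<n. w j) = (\<Sum>j<f n. b j) + (\<Sum>j<n - f n. c j)" for n
    using interleave_sums[of f n b c, OF f0 f_Suc] unfolding w_def by auto
  have "bounded_discrepancy p w (u *\<^sub>R x + (1 - u) *\<^sub>R y)"
    unfolding bounded_discrepancy_def
  proof
    fix i
    obtain B where B: "\<And>n. p i ((\<Sum>j<n. b j) - real n *\<^sub>R x) \<le> B"
      using b(1) unfolding bounded_discrepancy_def by blast
    obtain C where C: "\<And>n. p i ((\<Sum>j<n. c j) - real n *\<^sub>R y) \<le> C"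
      using c(1) unfolding bounded_discrepancy_def by blast
    have "p i ((\<Sum>j<n. w j) - real n *\<^sub>R (u *\<^sub>R x + (1 - u) *\<^sub>R y)) \<le> B + C + p i (x - y)" for n
    proof -
      let ?s = "(\<Sum>j<f n. b j) - real (f n) *\<^sub>R x"
      let ?t = "(\<Sum>j<n - f n. c j) - real (n - f n) *\<^sub>R y"
      let ?d = "(real (f n) - real n * u) *\<^sub>R (x - y)"
      have "(\<Sum>j<n. w j) - real n *\<^sub>R (u *\<^sub>R x + (1 - u) *\<^sub>R y) = (?s + ?t) + ?d"
        using sums[of n] by (simp add: of_nat_diff algebra_simps)
      also have "p i \<dots> \<le> p i ?s + p i ?t + p i ?d"
        using seminorm_triangle[OF p, of i "?s + ?t" ?d] seminorm_triangle[OF p, of i ?s ?t] by linarith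
      also have "p i ?d \<le> p i (x - y)"
      proof -
        have "\<bar>real (f n) - real n * u\<bar> \<le> 1"
          using f_bounds[of n] by linarith
        then show ?thesis
          using mult_right_mono[of "\<bar>real (f n) - real n * u\<bar>" 1 "p i (x - y)"]
          by (simp add: seminorm_scaleR[OF p] seminorm_nonneg[OF p])
      qed
      finally show ?thesis
        using B[of "f n"] C[of "n - f n"] by linarith
    qed
    then show "\<exists>C. \<forall>n. p i ((\<Sum>j<n. w j) - real n *\<^sub>R (u *\<^sub>R x + (1 - u) *\<^sub>R y)) \<le> C"
      by blast
  qed
  moreover have "range w \<subseteq> A"
    using b(2) c(2) by (auto simp: w_def)
  ultimately show ?thesis by blast
qed

text \<open>The points attained in this way form a convex set, by interleaving, and it contains
  \<open>A\<close>, by constant sequences.\<close>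

lemma convex_hull_bounded_discrepancy:
  assumes p: "\<And>i. seminorm (p i)" and x: "x \<in> convex hull A"
  shows "\<exists>b. range b \<subseteq> A \<and> bounded_discrepancy p b x"
proof -
  let ?P = "{x. \<exists>b. range b \<subseteq> A \<and> bounded_discrepancy p b x}"
  have "A \<subseteq> ?P"
  proof
    fix a assume "a \<in> A"
    then have "range (\<lambda>_::nat. a) \<subseteq> A \<and> bounded_discrepancy p (\<lambda>_. a) a"
      using p by (auto simp: bounded_discrepancy_def sum_constant_scaleR)
    then show "a \<in> ?P" by blast
  qed
  moreover have "convex ?P"
    unfolding convex_alt
    using bounded_discrepancy_interleave[of p, OF p, of "1 - u" for u] by fastforce
  ultimately have "convex hull A \<subseteq> ?P"
    by (rule hull_minimal)
  then show ?thesis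
    using x by blast
qed

text \<open>A finite prefix changes the discrepancy of the tail by a bounded amount only, and
  division by \<open>n\<close> removes it in the limit.\<close>

lemma extend_to_cesaro_convergent:
  fixes p :: "'i \<Rightarrow> 'v::real_vector \<Rightarrow> real"
  assumes p: "\<And>i. seminorm (p i)" and x: "x \<in> convex hull A" and \<theta>: "\<theta> \<in> {1..} \<rightarrow>\<^sub>E A"
  shows "\<exists>\<eta> \<in> {1..} \<rightarrow>\<^sub>E A. (\<forall>j\<le>m. \<eta> j = \<theta> j) \<and> (\<forall>i. (\<lambda>n. p i (cesaro \<eta> n - x)) \<longlonglongrightarrow> 0)"
proof -
  obtain b where b: "range b \<subseteq> A" "bounded_discrepancy p b x"
    using convex_hull_bounded_discrepancy[of p, OF p x] by blast
  \<comment> \<open>The sequence \<open>b\<close> starts at index 0, hence the shift by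
    \<open>Suc m\<close>. Index 0 keeps the value of \<open>\<theta>\<close>, so
    \<open>\<eta>\<close> remains undefined outside the index set.\<close>
  define \<eta> where "\<eta> j = (if j \<le> m then \<theta> j else b (j - Suc m))" for j
  have "(\<lambda>n. p i (cesaro \<eta> n - x)) \<longlonglongrightarrow> 0" for i
  proof -
    obtain C where C: "\<And>n. p i ((\<Sum>j<n. b j) - real n *\<^sub>R x) \<le> C"
      using b(2) unfolding bounded_discrepancy_def by blast
    define c where "c = (\<Sum>j=1..m. \<theta> j) - real m *\<^sub>R x"
    have bound: "p i (cesaro \<eta> n - x) \<le> (p i c + C) / real n" if n: "n \<ge> Suc m" for n
    proof -
      have "(\<Sum>j=1..n. \<eta> j) = (\<Sum>j=1..m. \<eta> j) + (\<Sum>j=Suc m..n. \<eta> j)"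
        using n sum.ub_add_nat[of 1 m \<eta> "n - m"] by simp
      also have "(\<Sum>j=Suc m..n. \<eta> j) = (\<Sum>j<n - m. b j)"
        by (rule sum.reindex_bij_witness[of _ "\<lambda>j. j + Suc m" "\<lambda>j. j - Suc m"])
          (use n in \<open>auto simp: \<eta>_def\<close>)
      finally have "(\<Sum>j=1..n. \<eta> j) = (\<Sum>j=1..m. \<theta> j) + (\<Sum>j<n - m. b j)"
        by (simp add: \<eta>_def)
      then have sum: "(\<Sum>j=1..n. \<eta> j) - real n *\<^sub>R x
          = c + ((\<Sum>j<n - m. b j) - real (n - m) *\<^sub>R x)"
        using n by (simp add: c_def of_nat_diff algebra_simps)
      have "cesaro \<eta> n - x = (1 / real n) *\<^sub>R ((\<Sum>j=1..n. \<eta> j) - real n *\<^sub>R x)"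
        using n by (simp add: cesaro_apply scaleR_diff_right)
      then have "p i (cesaro \<eta> n - x)
          = p i (c + ((\<Sum>j<n - m. b j) - real (n - m) *\<^sub>R x)) / real n"
        unfolding sum by (simp add: seminorm_scaleR[OF p])
      also have "\<dots> \<le> (p i c + C) / real n"
        using seminorm_triangle[OF p, of i c] C[of "n - m"]
        by (intro divide_right_mono) (smt (verit), simp)
      finally show ?thesis .
    qed
    show ?thesis
    proof (rule tendsto_sandwich[OF _ _ tendsto_const lim_const_over_n])
      show "\<forall>\<^sub>F n in sequentially. 0 \<le> p i (cesaro \<eta> n - x)"
        by (simp add: seminorm_nonneg[OF p])
      show "\<forall>\<^sub>F n in sequentially. p i (cesaro \<eta> n - x) \<le> (p i c + C) / real n"
        using eventually_ge_at_top by (rule eventually_mono) (rule bound)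
    qed
  qed
  moreover have "\<eta> \<in> {1..} \<rightarrow>\<^sub>E A"
    using \<theta> b(1) by (auto simp: \<eta>_def PiE_iff extensional_def)
  moreover have "\<forall>j\<le>m. \<eta> j = \<theta> j"
    by (simp add: \<eta>_def)
  ultimately show ?thesis
    by blast
qed

section \<open>Density by category\<close>

text \<open>As \<open>S\<close> lies in \<open>C\<close>, density in the subspace means that
  \<open>C\<close> is contained in the closure of \<open>S\<close> in \<open>X\<close>, and closure
  can be tested on a base.\<close>

lemma dense_in_subtopology_iff:
  assumes base: "\<And>V. V \<in> \<B> \<Longrightarrow> openin X V"
      "\<And>U x. openin X U \<Longrightarrow> x \<in> U \<Longrightarrow> \<exists>V\<in>\<B>. x \<in> V \<and> V \<subseteq> U"
    and "C \<subseteq> topspace X" and "S \<subseteq> C"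
  shows "dense_in (subtopology X C) S \<longleftrightarrow> (\<forall>V\<in>\<B>. V \<inter> C \<noteq> {} \<longrightarrow> V \<inter> S \<noteq> {})"
proof -
  have "dense_in (subtopology X C) S \<longleftrightarrow> C \<subseteq> X closure_of S"
  proof -
    have "topspace (subtopology X C) = C" and "C \<inter> S = S"
      using assms(3,4) by auto
    then show ?thesis
      using assms(4) unfolding dense_in_def closure_of_subtopology
      by (simp only: simp_thms inf.absorb_iff1)
  qed
  also have "\<dots> \<longleftrightarrow> (\<forall>V\<in>\<B>. V \<inter> C \<noteq> {} \<longrightarrow> V \<inter> S \<noteq> {})"
  proof
    assume C: "C \<subseteq> X closure_of S"
    show "\<forall>V\<in>\<B>. V \<inter> C \<noteq> {} \<longrightarrow> V \<inter> S \<noteq> {}"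
    proof (intro ballI impI)
      fix V assume V: "V \<in> \<B>" "V \<inter> C \<noteq> {}"
      then obtain x where "x \<in> V" "x \<in> X closure_of S"
        using C by blast
      then show "V \<inter> S \<noteq> {}"
        using base(1)[OF V(1)] unfolding in_closure_of by blast
    qed
  next
    assume R: "\<forall>V\<in>\<B>. V \<inter> C \<noteq> {} \<longrightarrow> V \<inter> S \<noteq> {}"
    show "C \<subseteq> X closure_of S"
    proof
      fix x assume x: "x \<in> C"
      have "\<exists>y. y \<in> S \<and> y \<in> U" if "openin X U" "x \<in> U" for U
        using base(2)[OF that] R x by blast
      then show "x \<in> X closure_of S"
        using x assms(3) by (auto simp: in_closure_of)
    qed
  qed
  finally show ?thesis .
qed

section \<open>Sequences over \<open>A\<close> with the discrete topology on
  \<open>A\<close>\<close>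

abbreviation discrete_seq_space :: "'a set \<Rightarrow> (nat \<Rightarrow> 'a) topology" where
  "discrete_seq_space A \<equiv> product_topology (\<lambda>_. discrete_topology A) {1..}"

lemma completely_metrizable_discrete_seq_space:
  "completely_metrizable_space (discrete_seq_space A)"
  by (simp add: completely_metrizable_space_product_topology
      completely_metrizable_space_discrete_topology)

text \<open>The identity from the discrete product is continuous, since it is so in each coordinate:
  every map out of a discrete space is continuous.\<close>

lemma openin_discrete_seq_space:
  assumes "A \<subseteq> topspace X" and "openin (seq_space X A) W"
  shows "openin (discrete_seq_space A) W"
proof -
  have id: "continuous_map (discrete_topology A) (subtopology X A) (\<lambda>x. x)"
    using assms(1) by (simp add: Int_absorb1 subset_eq)
  have "continuous_map (discrete_seq_space A) (subtopology X A) (\<lambda>\<theta>. \<theta> j)"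
      if "j \<in> {1..}" for j
  proof -
    have "continuous_map (discrete_seq_space A) (discrete_topology A) (\<lambda>\<theta>. \<theta> j)"
      using continuous_map_product_projection[of j "{1..}" "\<lambda>_. discrete_topology A"] that by simp
    from continuous_map_compose[OF this id] show ?thesis
      by (simp add: o_def)
  qed
  then have "continuous_map (discrete_seq_space A) (seq_space X A) (\<lambda>\<theta>. \<theta>)"
    unfolding seq_space_def by (auto simp: continuous_map_componentwise PiE_iff)
  then have "openin (discrete_seq_space A) {\<theta> \<in> topspace (discrete_seq_space A). \<theta> \<in> W}"
    using assms(2) by (rule openin_continuous_map_preimage)
  moreover have "W \<subseteq> {1..} \<rightarrow>\<^sub>E A"
    using openin_subset[OF assms(2)] assms(1) by (simp add: seq_space_def Int_absorb1)
  ultimately show ?thesis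
    by (simp add: Int_absorb1 Collect_conj_eq)
qed

text \<open>A basic open box restricts finitely many coordinates; \<open>m\<close> bounds their
  indices.\<close>

lemma discrete_seq_space_nbhd:
  assumes "openin (discrete_seq_space A) W" and "\<theta> \<in> W"
  shows "\<exists>m. \<forall>\<eta> \<in> {1..} \<rightarrow>\<^sub>E A. (\<forall>j\<le>m. \<eta> j = \<theta> j) \<longrightarrow> \<eta> \<in> W"
proof -
  obtain U where U: "finite {i \<in> {1..}. U i \<noteq> A}" "\<theta> \<in> Pi\<^sub>E {1..} U" "Pi\<^sub>E {1..} U \<subseteq> W"
    using assms unfolding openin_product_topology_alt by auto
  then obtain m where m: "\<And>i. i \<in> {1..} \<Longrightarrow> U i \<noteq> A \<Longrightarrow> i \<le> m"
    using finite_nat_set_iff_bounded_le by (metis (mono_tags, lifting) mem_Collect_eq)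
  have "\<eta> \<in> W" if "\<eta> \<in> {1..} \<rightarrow>\<^sub>E A" "\<forall>j\<le>m. \<eta> j = \<theta> j" for \<eta>
  proof -
    have "\<eta> j \<in> U j" if j: "j \<in> {1..}" for j
      using m[OF j] U(2) \<open>\<forall>j\<le>m. \<eta> j = \<theta> j\<close> \<open>\<eta> \<in> {1..} \<rightarrow>\<^sub>E A\<close> j
      by (metis PiE_mem)
    then show ?thesis
      using U(3) that(1) by (metis PiE_iff subsetD)
  qed
  then show ?thesis by blast
qed

theorem theorem3p1:
  fixes X :: "'v::real_vector topology" and A :: "'v set"
  assumes "metrizable_lcs X" and "separable_space X"
  shows "dense_in (seq_space X A) (Theta X A) \<and> gdelta_in (seq_space X A) (Theta X A)"
proof -
  obtain p :: "nat \<Rightarrow> 'v \<Rightarrow> real" where p: "\<And>i. seminorm (p i)" and X: "X = seminorm_topology p"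
    using assms(1) unfolding metrizable_lcs_def by blast
  have top: "topspace X = UNIV"
    unfolding X by (rule topspace_seminorm_topology[of p, OF p])
  have topS: "topspace (seq_space X A) = {1..} \<rightarrow>\<^sub>E A"
    by (simp add: seq_space_def top)
  have "second_countable X"
    using second_countable_seminorm_topology[of p, OF p] assms(2) unfolding X by simp
  then obtain \<B> where "countable \<B>" and "\<forall>V\<in>\<B>. openin X V"
      and "\<forall>U x. openin X U \<and> x \<in> U \<longrightarrow> (\<exists>V\<in>\<B>. x \<in> V \<and> V \<subseteq> U)"
    unfolding second_countable_def by (elim exE conjE)
  then have base: "\<And>V. V \<in> \<B> \<Longrightarrow> openin X V"
      "\<And>U x. openin X U \<Longrightarrow> x \<in> U \<Longrightarrow> \<exists>V\<in>\<B>. x \<in> V \<and> V \<subseteq> U"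
    by simp_all
  define H where "H k V = {\<theta> \<in> {1..} \<rightarrow>\<^sub>E A. \<exists>n\<ge>1. (cesaro ^^ k) \<theta> n \<in> V}" for k V
  \<comment> \<open>Base sets missing the hull impose no condition, because all terms of the
    iterated means stay in the hull.\<close>
  define I where "I = {1::nat..} \<times> {V \<in> \<B>. V \<inter> convex hull A \<noteq> {}}"
  \<comment> \<open>The whole space is included so that the family is nonempty also when \<open>A\<close> is empty.\<close>
  define \<G> where "\<G> = insert ({1..} \<rightarrow>\<^sub>E A) ((\<lambda>(k, V). H k V) ` I)"
  have "countable I"
    unfolding I_def using \<open>countable \<B>\<close> by (intro countable_SIGMA) auto
  then have "countable \<G>"
    by (simp add: \<G>_def)
  have hull: "(cesaro ^^ k) \<theta> ` {1..} \<subseteq> convex hull A" if "\<theta> \<in> {1..} \<rightarrow>\<^sub>E A" for \<theta> k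
  proof -
    have "\<theta> j \<in> convex hull A" if "j \<ge> 1" for j
      using \<open>\<theta> \<in> {1..} \<rightarrow>\<^sub>E A\<close> that by (metis PiE_mem atLeast_iff hull_inc)
    then show ?thesis
      by (intro image_subsetI cesaro_iterate_in_convex convex_convex_hull) simp_all
  qed
  have dense_iff: "dense_in (subtopology X (convex hull A)) ((cesaro ^^ k) \<theta> ` {1..}) \<longleftrightarrow>
      (\<forall>V\<in>\<B>. V \<inter> convex hull A \<noteq> {} \<longrightarrow> \<theta> \<in> H k V)" if "\<theta> \<in> {1..} \<rightarrow>\<^sub>E A" for \<theta> k
  proof -
    have "V \<inter> (cesaro ^^ k) \<theta> ` {1..} \<noteq> {} \<longleftrightarrow> \<theta> \<in> H k V" for V
      using that by (auto simp: H_def)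
    then show ?thesis
      by (subst dense_in_subtopology_iff[OF base _ hull[OF that]]) (auto simp: top)
  qed
  have "\<theta> \<in> Theta X A \<longleftrightarrow> \<theta> \<in> \<Inter>\<G>" for \<theta>
  proof -
    have "\<theta> \<in> Theta X A \<longleftrightarrow> \<theta> \<in> {1..} \<rightarrow>\<^sub>E A \<and>
        (\<forall>k\<ge>1. \<forall>V\<in>\<B>. V \<inter> convex hull A \<noteq> {} \<longrightarrow> \<theta> \<in> H k V)"
      unfolding Theta_def mem_Collect_eq by (rule conj_cong[OF refl]) (simp only: dense_iff)
    also have "\<dots> \<longleftrightarrow> \<theta> \<in> \<Inter>\<G>"
      by (auto simp: \<G>_def I_def)
    finally show ?thesis .
  qed
  then have Theta: "Theta X A = \<Inter>\<G>"
    by blast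
  have openH: "openin (seq_space X A) (H k V)" if "openin X V" for k V
  proof -
    have "openin (seq_space X A) {\<theta> \<in> {1..} \<rightarrow>\<^sub>E A. (cesaro ^^ k) \<theta> n \<in> V}" if "n \<in> {1..}" for n
      using openin_cesaro_iterate[of p V n A k, OF p] \<open>openin X V\<close> that unfolding X by simp
    then have "openin (seq_space X A) (\<Union>n\<in>{1..}. {\<theta> \<in> {1..} \<rightarrow>\<^sub>E A. (cesaro ^^ k) \<theta> n \<in> V})"
      by (intro openin_Union) blast
    moreover have "H k V = (\<Union>n\<in>{1..}. {\<theta> \<in> {1..} \<rightarrow>\<^sub>E A. (cesaro ^^ k) \<theta> n \<in> V})"
      by (auto simp: H_def)
    ultimately show ?thesis
      by (simp only:)
  qed
  have open\<G>: "openin (seq_space X A) W" if "W \<in> \<G>" for W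
    using that openH base(1) openin_topspace[of "seq_space X A"] by (auto simp: \<G>_def I_def topS)
  have dense\<G>: "discrete_seq_space A closure_of W = topspace (discrete_seq_space A)" if "W \<in> \<G>" for W
  proof (cases "W = {1..} \<rightarrow>\<^sub>E A")
    case True
    then show ?thesis
      using closure_of_topspace[of "discrete_seq_space A"] by simp
  next
    case False
    then have "W \<in> (\<lambda>(k, V). H k V) ` I"
      using that unfolding \<G>_def by blast
    then obtain k V x where W: "W = H k V" and "k \<ge> 1" "V \<in> \<B>" and x: "x \<in> V" "x \<in> convex hull A"
      by (auto simp: I_def)
    have "\<exists>\<eta>. \<eta> \<in> W \<and> \<eta> \<in> N" if N: "openin (discrete_seq_space A) N" "\<theta> \<in> N" for \<theta> N
    proof -
      have \<theta>: "\<theta> \<in> {1..} \<rightarrow>\<^sub>E A"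
        using openin_subset[OF N(1)] N(2) by auto
      obtain m where m: "\<And>\<eta>. \<eta> \<in> {1..} \<rightarrow>\<^sub>E A \<Longrightarrow> \<forall>j\<le>m. \<eta> j = \<theta> j \<Longrightarrow> \<eta> \<in> N"
        using discrete_seq_space_nbhd[OF N] by blast
      \<comment> \<open>The prefix shared with \<open>\<theta>\<close> keeps \<open>\<eta>\<close>
        in \<open>N\<close>, while its tail drives the iterated means to \<open>x\<close> and so
        into \<open>V\<close>.\<close>
      obtain \<eta> where \<eta>: "\<eta> \<in> {1..} \<rightarrow>\<^sub>E A" "\<forall>j\<le>m. \<eta> j = \<theta> j"
        and lim: "\<And>i. (\<lambda>n. p i (cesaro \<eta> n - x)) \<longlonglongrightarrow> 0"
        using extend_to_cesaro_convergent[of p, OF p x(2) \<theta>] by blast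
      have "\<forall>\<^sub>F n in sequentially. (cesaro ^^ k) \<eta> n \<in> V"
        using cesaro_iterate_tendsto[OF p lim \<open>k \<ge> 1\<close>] base(1)[OF \<open>V \<in> \<B>\<close>] x(1)
        unfolding X by (intro seminorm_topology_eventually[of p, OF p])
      then have "\<forall>\<^sub>F n in sequentially. 1 \<le> n \<and> (cesaro ^^ k) \<eta> n \<in> V"
        by (intro eventually_conj eventually_ge_at_top)
      then have "\<eta> \<in> W"
        using \<eta>(1) by (auto simp: W H_def dest!: eventually_happens)
      then show ?thesis
        using m[OF \<eta>] by blast
    qed
    then show ?thesis
      unfolding closure_of_def by blast
  qed
  have A: "A \<subseteq> topspace X"
    by (simp add: top)
  \<comment> \<open>Baire category is applied in the discrete product, where the members of
    \<open>\<G>\<close> are open because that topology is finer.\<close>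
  have dense: "discrete_seq_space A closure_of \<Inter>\<G> = topspace (discrete_seq_space A)"
    using \<open>countable \<G>\<close> completely_metrizable_discrete_seq_space dense\<G>
      openin_discrete_seq_space[OF A open\<G>] by (intro Baire_category) auto
  \<comment> \<open>Density passes to the coarser topology, which has fewer open sets to
    meet.\<close>
  have "\<theta> \<in> seq_space X A closure_of \<Inter>\<G>" if "\<theta> \<in> {1..} \<rightarrow>\<^sub>E A" for \<theta>
  proof -
    have "\<theta> \<in> discrete_seq_space A closure_of \<Inter>\<G>"
      using that unfolding dense by simp
    then show ?thesis
      using that openin_discrete_seq_space[OF A] unfolding in_closure_of topS by blast
  qed
  moreover have "\<Inter>\<G> \<subseteq> {1..} \<rightarrow>\<^sub>E A"
    by (auto simp: \<G>_def)
  ultimately have "dense_in (seq_space X A) (Theta X A)"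
    unfolding dense_in_def Theta topS
    using closure_of_subset_topspace[of "seq_space X A"] topS by blast
  moreover have "gdelta_in (seq_space X A) (Theta X A)"
    unfolding Theta using \<open>countable \<G>\<close> open\<G>
    by (intro gdelta_in_Inter open_imp_gdelta_in) (auto simp: \<G>_def)
  ultimately show ?thesis ..
qed

end
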